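(* Let $(C,\cdot,\circ)$ be a nonzero $2$-dimensional commutative pre-Lie algebra over $\mathbb C$ (a structure with two products, see context). Then $C$ is isomorphic to one of the following algebras with basis $e_1,e_2$ (where $\alpha\in\mathbb C$). (a) Algebras with zero product $\cdot$: $C_{01}: e_1\circ e_1=e_1+e_2,\ e_2\circ e_1=e_2$; $C_{02}: e_1\circ e_1=e_1+e_2,\ e_1\circ e_2=e_2$; $C_{03}: e_1\circ e_1=e_2$; $C_{04}: e_2\circ e_1=e_1$; $C_{05}^{\alpha}: e_1\circ e_1=e_1,\ e_1\circ e_2=\alpha e_2$; $C_{06}^{\alpha}: e_1\circ e_1=e_1,\ e_1\circ e_2=\alpha e_2,\ e_2\circ e_1=e_2$; $C_{07}: e_1\circ e_1=e_1,\ e_2\circ e_2=e_2$; $C_{08}: e_1\circ e_1=e_1,\ e_1\circ e_2=2e_2,\ e_2\circ e_1=\frac12 e_1+e_2,\ e_2\circ e_2=e_2$. (b) Algebras with nonzero product $\cdot$: $C_{09}: e_1\cdot e_1=e_1,\ e_2\cdot e_2=e_2$; $C_{10}^{\alpha}: e_1\cdot e_1=e_1,\ e_1\cdot e_2=e_2,\ e_1\circ e_2=\alpha e_2$; $C_{11}: e_1\cdot e_1=e_1,\ e_1\cdot e_2=e_2,\ e_2\circ e_2=e_2$; $C_{12}^{\alpha}: e_1\cdot e_1=e_1,\ e_1\circ e_2=\alpha e_2$; $C_{13}: e_1\cdot e_1=e_1,\ e_2\circ e_2=e_2$; $C_{14}: e_1\cdot e_1=e_2,\ e_1\circ e_1=e_1,\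 e_1\circ e_2=2e_2$; $C_{15}^{\alpha}: e_1\cdot e_1=e_2,\ e_1\circ e_1=\alpha e_1,\ e_1\circ e_2=2\alpha e_2,\ e_2\circ e_1=e_1+\alpha e_2,\ e_2\circ e_2=2e_2$; $C_{16}: e_1\cdot e_1=e_2,\ e_1\circ e_1=e_1,\ e_1\circ e_2=2e_2,\ e_2\circ e_1=e_2$; $C_{17}^{\alpha}: e_1\cdot e_1=e_2,\ e_1\circ e_1=\alpha e_2$. Between the algebras in (b), the only non-trivial isomorphisms are $C_{15}^{\alpha}\cong C_{15}^{-\alpha}$.
   Context: A commutative pre-Lie algebra is a complex vector space with a commutative associative product $\cdot$ and a pre-Lie product $\circ$, i.e. a bilinear product with $(x\circ y)\circ z-(y\circ x)\circ z=x\circ(y\circ z)-y\circ(x\circ z)$, such that $x\circ(y\cdot z)=(x\circ y)\cdot z+y\cdot(x\circ z)$. It is nonzero if the two products are not both zero. Isomorphisms are linear bijections preserving both products. In multiplication tables, products of basis elements not listed are zero, except that $e_2\cdot e_1=e_1\cdot e_2$ by commutativity of $\cdot$ (the product $\circ$ is not assumed commutative). *)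

theory Defs
  imports "HOL-Analysis.Analysis"
begin

definition bilinear_product :: "(complex \<Rightarrow> 'a::ab_group_add \<Rightarrow> 'a) \<Rightarrow> ('a \<Rightarrow> 'a \<Rightarrow> 'a) \<Rightarrow> bool" where
  "bilinear_product scl m \<longleftrightarrow>
     (\<forall>x. Vector_Spaces.linear scl scl (\<lambda>y. m x y)) \<and>
     (\<forall>y. Vector_Spaces.linear scl scl (\<lambda>x. m x y))"

locale comm_pre_Lie_algebra = vector_space scl
  for scl :: "complex \<Rightarrow> 'a::ab_group_add \<Rightarrow> 'a" +
  fixes dot :: "'a \<Rightarrow> 'a \<Rightarrow> 'a"  (infixl "\<bullet>\<^sub>C" 70)
    and circ :: "'a \<Rightarrow> 'a \<Rightarrow> 'a"  (infixl "\<circ>\<^sub>C" 70)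
  assumes dot_bilinear: "bilinear_product scl dot"
    and circ_bilinear: "bilinear_product scl circ"
    and dot_commute: "x \<bullet>\<^sub>C y = y \<bullet>\<^sub>C x"
    and dot_assoc: "(x \<bullet>\<^sub>C y) \<bullet>\<^sub>C z = x \<bullet>\<^sub>C (y \<bullet>\<^sub>C z)"
    and pre_Lie: "(x \<circ>\<^sub>C y) \<circ>\<^sub>C z - (y \<circ>\<^sub>C x) \<circ>\<^sub>C z = x \<circ>\<^sub>C (y \<circ>\<^sub>C z) - y \<circ>\<^sub>C (x \<circ>\<^sub>C z)"
    and Leibniz: "x \<circ>\<^sub>C (y \<bullet>\<^sub>C z) = (x \<circ>\<^sub>C y) \<bullet>\<^sub>C z + y \<bullet>\<^sub>C (x \<circ>\<^sub>C z)"

definition nonzero_products :: "('a::zero \<Rightarrow> 'a \<Rightarrow> 'a) \<Rightarrow> ('a \<Rightarrow> 'a \<Rightarrow> 'a) \<Rightarrow> bool" where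
  "nonzero_products dot circ \<longleftrightarrow> \<not> ((\<forall>x y. dot x y = 0) \<and> (\<forall>x y. circ x y = 0))"

definition isomorphic_algebras ::
  "(complex \<Rightarrow> 'a::ab_group_add \<Rightarrow> 'a) \<Rightarrow> ('a \<Rightarrow> 'a \<Rightarrow> 'a) \<Rightarrow> ('a \<Rightarrow> 'a \<Rightarrow> 'a) \<Rightarrow>
   (complex \<Rightarrow> 'b::ab_group_add \<Rightarrow> 'b) \<Rightarrow> ('b \<Rightarrow> 'b \<Rightarrow> 'b) \<Rightarrow> ('b \<Rightarrow> 'b \<Rightarrow> 'b) \<Rightarrow> bool" where
  "isomorphic_algebras scl dot circ scl' dot' circ' \<longleftrightarrow>
     (\<exists>f. Vector_Spaces.linear scl scl' f \<and> bij f \<and>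
          (\<forall>x y. f (dot x y) = dot' (f x) (f y)) \<and>
          (\<forall>x y. f (circ x y) = circ' (f x) (f y)))"

abbreviation e1 :: "complex^2" where "e1 \<equiv> axis 1 1"
abbreviation e2 :: "complex^2" where "e2 \<equiv> axis 2 1"

text \<open>The bilinear product on \<open>complex^2\<close> with values \<open>p11\<close>, \<open>p12\<close>, \<open>p21\<close>, \<open>p22\<close> on the
  pairs of basis vectors \<open>(e1, e1)\<close>, \<open>(e1, e2)\<close>, \<open>(e2, e1)\<close>, \<open>(e2, e2)\<close>, in this order.\<close>

definition table ::
  "complex^2 \<Rightarrow> complex^2 \<Rightarrow> complex^2 \<Rightarrow> complex^2 \<Rightarrow> complex^2 \<Rightarrow> complex^2 \<Rightarrow> complex^2" where
  "table p11 p12 p21 p22 x y =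
     (x$1 * y$1) *s p11 + (x$1 * y$2) *s p12 + (x$2 * y$1) *s p21 + (x$2 * y$2) *s p22"

text \<open>Elements of \<open>alg\<close> are only names of multiplication tables: equality in \<open>alg\<close> is equality of
  name and parameter, not isomorphism.  Family \<open>a\<close> has zero commutative product, family \<open>b\<close>
  nonzero commutative product (see \<open>alg_dot_zero_iff\<close> below).\<close>

datatype alg =
    C01 | C02 | C03 | C04 | C05 complex | C06 complex | C07 | C08
  | C09 | C10 complex | C11 | C12 complex | C13 | C14 | C15 complex | C16 | C17 complex

definition family_a :: "alg set" where
  "family_a = {C01, C02, C03, C04, C07, C08} \<union> range C05 \<union> range C06"

definition family_b :: "alg set" where
  "family_b = {C09, C11, C13, C14, C16} \<union> range C10 \<union> range C12 \<union> range C15 \<union> range C17"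

fun alg_dot :: "alg \<Rightarrow> complex^2 \<Rightarrow> complex^2 \<Rightarrow> complex^2" where
  "alg_dot C01 = table 0 0 0 0"
| "alg_dot C02 = table 0 0 0 0"
| "alg_dot C03 = table 0 0 0 0"
| "alg_dot C04 = table 0 0 0 0"
| "alg_dot (C05 \<alpha>) = table 0 0 0 0"
| "alg_dot (C06 \<alpha>) = table 0 0 0 0"
| "alg_dot C07 = table 0 0 0 0"
| "alg_dot C08 = table 0 0 0 0"
| "alg_dot C09 = table e1 0 0 e2"
| "alg_dot (C10 \<alpha>) = table e1 e2 e2 0"
| "alg_dot C11 = table e1 e2 e2 0"
| "alg_dot (C12 \<alpha>) = table e1 0 0 0"
| "alg_dot C13 = table e1 0 0 0"
| "alg_dot C14 = table e2 0 0 0"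
| "alg_dot (C15 \<alpha>) = table e2 0 0 0"
| "alg_dot C16 = table e2 0 0 0"
| "alg_dot (C17 \<alpha>) = table e2 0 0 0"

fun alg_circ :: "alg \<Rightarrow> complex^2 \<Rightarrow> complex^2 \<Rightarrow> complex^2" where
  "alg_circ C01 = table (e1 + e2) 0 e2 0"
| "alg_circ C02 = table (e1 + e2) e2 0 0"
| "alg_circ C03 = table e2 0 0 0"
| "alg_circ C04 = table 0 0 e1 0"
| "alg_circ (C05 \<alpha>) = table e1 (\<alpha> *s e2) 0 0"
| "alg_circ (C06 \<alpha>) = table e1 (\<alpha> *s e2) e2 0"
| "alg_circ C07 = table e1 0 0 e2"
| "alg_circ C08 = table e1 (2 *s e2) ((1/2) *s e1 + e2) e2"
| "alg_circ C09 = table 0 0 0 0"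
| "alg_circ (C10 \<alpha>) = table 0 (\<alpha> *s e2) 0 0"
| "alg_circ C11 = table 0 0 0 e2"
| "alg_circ (C12 \<alpha>) = table 0 (\<alpha> *s e2) 0 0"
| "alg_circ C13 = table 0 0 0 e2"
| "alg_circ C14 = table e1 (2 *s e2) 0 0"
| "alg_circ (C15 \<alpha>) = table (\<alpha> *s e1) ((2 * \<alpha>) *s e2) (e1 + \<alpha> *s e2) (2 *s e2)"
| "alg_circ C16 = table e1 (2 *s e2) e2 0"
| "alg_circ (C17 \<alpha>) = table (\<alpha> *s e2) 0 0 0"

lemma families: "family_a \<union> family_b = UNIV" "family_a \<inter> family_b = {}"
proof -
  have "L \<in> family_a \<union> family_b" for L
    by (cases L) (auto simp: family_a_def family_b_def)
  then show "family_a \<union> family_b = UNIV" by blast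
  show "family_a \<inter> family_b = {}"
    by (auto simp: family_a_def family_b_def)
qed

lemma table_basis:
  "table p11 p12 p21 p22 e1 e1 = p11" "table p11 p12 p21 p22 e1 e2 = p12"
  "table p11 p12 p21 p22 e2 e1 = p21" "table p11 p12 p21 p22 e2 e2 = p22"
  by (simp_all add: table_def axis_def)

lemma bilinear_product_table: "bilinear_product (*s) (table p11 p12 p21 p22)"
  unfolding bilinear_product_def
  by (auto simp: Vector_Spaces.linear_iff vec.vector_space_axioms table_def vec_eq_iff algebra_simps)

lemma e12_nonzero: "e1 \<noteq> 0" "e2 \<noteq> 0" "e1 + e2 \<noteq> 0"
  by (auto simp: vec_eq_iff axis_def)

lemma alg_dot_zero_iff: "(\<forall>x y. alg_dot L x y = 0) \<longleftrightarrow> L \<in> family_a"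
proof
  assume *: "\<forall>x y. alg_dot L x y = 0"
  have "alg_dot L e1 e1 = 0" using * by blast
  then show "L \<in> family_a"
    by (cases L) (auto simp: family_a_def table_basis e12_nonzero)
next
  assume "L \<in> family_a"
  then show "\<forall>x y. alg_dot L x y = 0"
    by (auto simp: family_a_def table_def)
qed

lemma alg_nonzero: "nonzero_products (alg_dot L) (alg_circ L)"
proof -
  have "alg_dot L e1 e1 \<noteq> 0 \<or> alg_circ L e1 e1 \<noteq> 0 \<or> alg_circ L e2 e1 \<noteq> 0"
    by (cases L) (simp_all add: table_basis e12_nonzero)
  then show ?thesis unfolding nonzero_products_def by blast
qed

lemma alg_is_comm_pre_Lie_algebra:
  "comm_pre_Lie_algebra (*s) (alg_dot L) (alg_circ L)"
proof
  show "bilinear_product (*s) (alg_dot L)" "bilinear_product (*s) (alg_circ L)"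
    by (cases L; simp add: bilinear_product_table)+
qed (cases L; simp add: table_def vec_eq_iff forall_2 axis_def algebra_simps)+

end

theory Submission
  imports Defs
begin

text \<open>
  A nonzero commutative associative product on a complex plane has a basis \<open>u, v\<close> in one of four
  normal forms: \<open>u = u\<^sup>2\<close> with \<open>v\<close> in one of the two eigenspaces of multiplication by \<open>u\<close>, if there is a
  nonzero idempotent, and \<open>v = u\<^sup>2\<close>, \<open>u\<^sup>3 = 0\<close> otherwise.  If \<open>\<cdot>\<close> is nonzero, left multiplications for
  \<open>\<circ>\<close> are derivations of this normal form, so only few structure constants remain, and the pre-Lie
  identity cuts them down to the list.  If \<open>\<cdot>\<close> is zero and \<open>\<circ>\<close> is commutative, then \<open>\<circ>\<close> is
  associative and the same normal forms apply.  If \<open>\<circ>\<close> is not commutative, there is a basis \<open>h, w\<close> with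
  \<open>h \<circ> w - w \<circ> h = w\<close>; left multiplications then satisfy \<open>[L\<^sub>h, L\<^sub>w] = L\<^sub>w\<close>, so \<open>L\<^sub>w\<close> is
  nilpotent, and the cases are distinguished by \<open>w \<circ> w\<close> and \<open>w \<circ> h\<close>.

  For the second claim, the four normal forms are separated by having a unit, a nonzero element of
  square zero, or a nonzero idempotent; their automorphisms are explicit and act on the remaining
  parameters by at most a sign.
\<close>

section \<open>Isomorphisms and bases\<close>

text \<open>The coordinate map of an ordered pair. That \<open>u\<close>, \<open>v\<close> is a
  basis is expressed throughout as bijectivity of this map.\<close>

definition lincomb :: "(complex \<Rightarrow> 'a \<Rightarrow> 'a) \<Rightarrow> 'a \<Rightarrow> 'a \<Rightarrow> complex^2 \<Rightarrow> 'a::ab_group_add" where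
  "lincomb scl u v p = scl (p$1) u + scl (p$2) v"

definition det2 :: "complex^2 \<Rightarrow> complex^2 \<Rightarrow> complex" where
  "det2 u v = u$1 * v$2 - u$2 * v$1"

lemma isomorphic_algebras_sym:
  assumes "isomorphic_algebras scl dot circ scl' dot' circ'"
  shows "isomorphic_algebras scl' dot' circ' scl dot circ"
proof -
  obtain f where f: "Vector_Spaces.linear scl scl' f" "bij f"
    and d: "\<And>x y. f (dot x y) = dot' (f x) (f y)" and c: "\<And>x y. f (circ x y) = circ' (f x) (f y)"
    using assms unfolding isomorphic_algebras_def by blast
  interpret f: Vector_Spaces.linear scl scl' f by fact
  have fi: "f (inv f x) = x" for x
    using f(2) by (simp add: bij_is_surj surj_f_inv_f)
  have if': "inv f (f x) = x" for x
    using f(2) by (simp add: bij_is_inj)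
  have "Vector_Spaces.linear scl' scl (inv f)"
  proof
    show "inv f (b1 + b2) = inv f b1 + inv f b2" for b1 b2
      by (metis f.add fi if')
    show "inv f (scl' r b) = scl r (inv f b)" for r b
      by (metis f.scale fi if')
  qed
  moreover have "inv f (dot' x y) = dot (inv f x) (inv f y)" for x y
    by (metis d fi if')
  moreover have "inv f (circ' x y) = circ (inv f x) (inv f y)" for x y
    by (metis c fi if')
  ultimately show ?thesis
    unfolding isomorphic_algebras_def using f(2) bij_imp_bij_inv by blast
qed

lemma isomorphic_algebras_trans:
  assumes "isomorphic_algebras scl dot circ scl' dot' circ'"
    and "isomorphic_algebras scl' dot' circ' scl'' dot'' circ''"
  shows "isomorphic_algebras scl dot circ scl'' dot'' circ''"
proof -
  obtain f where f: "Vector_Spaces.linear scl scl' f" "bij f"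
    "\<And>x y. f (dot x y) = dot' (f x) (f y)" "\<And>x y. f (circ x y) = circ' (f x) (f y)"
    using assms(1) unfolding isomorphic_algebras_def by blast
  obtain g where g: "Vector_Spaces.linear scl' scl'' g" "bij g"
    "\<And>x y. g (dot' x y) = dot'' (g x) (g y)" "\<And>x y. g (circ' x y) = circ'' (g x) (g y)"
    using assms(2) unfolding isomorphic_algebras_def by blast
  have "Vector_Spaces.linear scl scl'' (g \<circ> f)"
    using f(1) g(1) by (rule Vector_Spaces.linear_compose)
  moreover have "bij (g \<circ> f)"
    using f(2) g(2) by (rule bij_comp)
  ultimately show ?thesis
    unfolding isomorphic_algebras_def using f g by (intro exI[of _ "g \<circ> f"]) simp
qed

lemma bilinear_product_lincomb:
  assumes "bilinear_product scl m"
  shows "m (lincomb scl u v x) (lincomb scl u v y) =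
    scl (x$1 * y$1) (m u u) + scl (x$1 * y$2) (m u v) +
    scl (x$2 * y$1) (m v u) + scl (x$2 * y$2) (m v v)"
proof -
  have l: "Vector_Spaces.linear scl scl (m x)" "Vector_Spaces.linear scl scl (\<lambda>x. m x y)" for x y
    using assms unfolding bilinear_product_def by auto
  interpret vector_space scl
    using l(1) by (simp add: Vector_Spaces.linear_iff)
  have "m (a + b) z = m a z + m b z" "m z (a + b) = m z a + m z b"
    "m (scl k a) z = scl k (m a z)" "m z (scl k a) = scl k (m z a)" for a b z k
    using l by (simp_all add: Vector_Spaces.linear_iff)
  then show ?thesis
    by (simp add: lincomb_def scale_right_distrib algebra_simps)
qed

text \<open>Bilinear products are determined by their values on pairs of basis vectors. The
  coordinate map goes from \<open>complex^2\<close> to the abstract space, so the isomorphism is its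
  inverse.\<close>

lemma isomorphic_algebras_table:
  assumes bil: "bilinear_product scl dot" "bilinear_product scl circ"
    and bij: "bij (lincomb scl u v)"
    and dot: "dot u u = lincomb scl u v p11" "dot u v = lincomb scl u v p12"
      "dot v u = lincomb scl u v p21" "dot v v = lincomb scl u v p22"
    and circ: "circ u u = lincomb scl u v q11" "circ u v = lincomb scl u v q12"
      "circ v u = lincomb scl u v q21" "circ v v = lincomb scl u v q22"
  shows "isomorphic_algebras scl dot circ (*s) (table p11 p12 p21 p22) (table q11 q12 q21 q22)"
proof -
  have "Vector_Spaces.linear scl scl (dot u)"
    using bil(1) unfolding bilinear_product_def by auto
  then interpret vector_space scl
    by (simp add: Vector_Spaces.linear_iff)
  have "Vector_Spaces.linear (*s) scl (lincomb scl u v)"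
    by (simp add: Vector_Spaces.linear_iff vec.vector_space_axioms vector_space_axioms
        lincomb_def algebra_simps)
  moreover have "lincomb scl u v (table p11 p12 p21 p22 x y) =
      dot (lincomb scl u v x) (lincomb scl u v y)" for x y
    unfolding bilinear_product_lincomb[OF bil(1)] dot
    by (simp add: lincomb_def table_def algebra_simps)
  moreover have "lincomb scl u v (table q11 q12 q21 q22 x y) =
      circ (lincomb scl u v x) (lincomb scl u v y)" for x y
    unfolding bilinear_product_lincomb[OF bil(2)] circ
    by (simp add: lincomb_def table_def algebra_simps)
  ultimately have "isomorphic_algebras (*s) (table p11 p12 p21 p22) (table q11 q12 q21 q22) scl dot circ"
    unfolding isomorphic_algebras_def using bij by blast
  then show ?thesis by (rule isomorphic_algebras_sym)
qed

text \<open>Transport of structure: it makes the identities available for tables, where evaluation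
  at basis vectors gives scalar equations.\<close>

lemma comm_pre_Lie_algebra_isomorphic:
  assumes "comm_pre_Lie_algebra scl dot circ"
    and "isomorphic_algebras scl dot circ scl' dot' circ'"
    and bil: "bilinear_product scl' dot'" "bilinear_product scl' circ'"
  shows "comm_pre_Lie_algebra scl' dot' circ'"
proof -
  interpret A: comm_pre_Lie_algebra scl dot circ by fact
  obtain f where f: "Vector_Spaces.linear scl scl' f" "bij f"
    and h: "\<And>x y. dot' (f x) (f y) = f (dot x y)" "\<And>x y. circ' (f x) (f y) = f (circ x y)"
    using assms(2) unfolding isomorphic_algebras_def by metis
  interpret f: Vector_Spaces.linear scl scl' f by fact
  have surj: "\<exists>x. y = f x" for y
    using f(2) by (metis bij_is_surj surjD)
  show ?thesis
  proof
    fix x' y' z'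
    obtain x y z where e: "x' = f x" "y' = f y" "z' = f z" using surj by metis
    show "dot' x' y' = dot' y' x'"
      by (simp add: e h A.dot_commute)
    show "dot' (dot' x' y') z' = dot' x' (dot' y' z')"
      by (simp only: e h A.dot_assoc)
    show "circ' (circ' x' y') z' - circ' (circ' y' x') z' = circ' x' (circ' y' z') - circ' y' (circ' x' z')"
      by (simp add: e h A.pre_Lie flip: f.diff)
    show "circ' x' (dot' y' z') = dot' (circ' x' y') z' + dot' y' (circ' x' z')"
      by (simp add: e h A.Leibniz flip: f.add)
  qed (use bil in auto)
qed

lemma bij_lincomb_vec_iff: "bij (lincomb (*s) u v) \<longleftrightarrow> det2 u v \<noteq> 0"
proof
  assume b: "bij (lincomb (*s) u v)"
  show "det2 u v \<noteq> 0"
  proof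
    assume d: "det2 u v = 0"
    have i: "p = q" if "lincomb (*s) u v p = lincomb (*s) u v q" for p q
      using b that by (meson bij_is_inj injD)
    \<comment> \<open>With determinant zero, both coefficient vectors give the combination zero.
      Injectivity forces \<open>u = 0\<close>, and then \<open>(1, 0)\<close> is sent to zero
      too.\<close>
    have "vector [v$2, -u$2] = (0::complex^2)" "vector [v$1, -u$1] = (0::complex^2)"
      by (rule i; use d in \<open>simp add: lincomb_def det2_def vec_eq_iff forall_2 algebra_simps\<close>)+
    then have "u = 0" by (simp add: vec_eq_iff forall_2)
    have "vector [1, 0] = (0::complex^2)"
      by (rule i) (simp add: \<open>u = 0\<close> lincomb_def vec_eq_iff forall_2)
    then show False by (simp add: vec_eq_iff forall_2)
  qed
next
  assume d: "det2 u v \<noteq> 0"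
  \<comment> \<open>The inverse is given by Cramer's rule.\<close>
  define g :: "complex^2 \<Rightarrow> complex^2" where
    "g x = vector [(x$1 * v$2 - x$2 * v$1) / det2 u v, (u$1 * x$2 - u$2 * x$1) / det2 u v]" for x
  have "g (lincomb (*s) u v x) = x" for x
  proof -
    have "(x$1 * u$1 + x$2 * v$1) * v$2 - (x$1 * u$2 + x$2 * v$2) * v$1 = x$1 * det2 u v"
      "u$1 * (x$1 * u$2 + x$2 * v$2) - u$2 * (x$1 * u$1 + x$2 * v$1) = x$2 * det2 u v"
      unfolding det2_def by algebra+
    then show ?thesis
      using d by (simp add: g_def lincomb_def vec_eq_iff forall_2)
  qed
  moreover have "lincomb (*s) u v (g x) = x" for x
  proof -
    have "(x$1 * v$2 - x$2 * v$1) * u$1 + (u$1 * x$2 - u$2 * x$1) * v$1 = x$1 * det2 u v"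
      "(x$1 * v$2 - x$2 * v$1) * u$2 + (u$1 * x$2 - u$2 * x$1) * v$2 = x$2 * det2 u v"
      unfolding det2_def by algebra+
    then show ?thesis
      using d by (simp add: g_def lincomb_def vec_eq_iff forall_2 flip: add_divide_distrib)
  qed
  ultimately show "bij (lincomb (*s) u v)"
    by (intro o_bij[of g]) (auto simp: fun_eq_iff)
qed

text \<open>The two elements of a basis in some order: independence makes the coordinate map
  injective, spanning makes it surjective.\<close>

lemma dim_2_basis:
  fixes scl :: "complex \<Rightarrow> 'a::ab_group_add \<Rightarrow> 'a"
  assumes "vector_space scl" "vector_space.dim scl (UNIV :: 'a set) = 2"
  obtains u v where "bij (lincomb scl u v)"
proof -
  interpret vector_space scl by fact
  obtain B where B: "independent B" "UNIV \<subseteq> span B" "card B = 2"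
    using basis_exists[of UNIV] assms(2) by metis
  obtain u v where uv: "B = {u, v}" "u \<noteq> v" using B(3) by (meson card_2_iff)
  have ind: "u \<notin> span {v}" "v \<noteq> 0"
    using B(1) uv by (auto simp: independent_insert)
  have "a = 0 \<and> b = 0" if "scl a u + scl b v = 0" for a b
  proof (cases "a = 0")
    case True
    then show ?thesis using that ind by simp
  next
    case False
    have "scl a u = scl (-b) v"
      using that by (simp add: eq_neg_iff_add_eq_0)
    then have "scl (inverse a) (scl a u) = scl (inverse a) (scl (-b) v)" by simp
    then have "u = scl (inverse a * - b) v" using False by simp
    then have "u \<in> span {v}" by (metis span_base span_scale singletonI)
    then show ?thesis using ind(1) by blast
  qed
  moreover have "scl (a - a') u + scl (b - b') v = 0"
    if "scl a u + scl b v = scl a' u + scl b' v" for a a' b b'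
    using that by (simp add: algebra_simps)
  ultimately have i: "a = a' \<and> b = b'" if "scl a u + scl b v = scl a' u + scl b' v" for a a' b b'
    using that by (metis right_minus_eq)
  have "inj (lincomb scl u v)"
    by (rule injI) (auto simp: lincomb_def vec_eq_iff forall_2 dest: i)
  moreover have "\<exists>p. x = lincomb scl u v p" for x
  proof -
    have "x \<in> span {u, v}" using B uv by auto
    then obtain a b where "x - scl a u = scl b v"
      by (auto simp: span_insert span_singleton)
    then have "x = lincomb scl u v (vector [a, b])"
      by (simp add: lincomb_def algebra_simps)
    then show ?thesis ..
  qed
  ultimately show ?thesis using that by (metis bijI surjI surj_def)
qed

lemma surj_lincomb:
  assumes "bij (lincomb scl u v)"
  obtains p where "x = lincomb scl u v p"
  using assms by (metis bij_is_surj surjD)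

lemma det2_eq_0D:
  assumes "det2 u v = 0" "u \<noteq> 0"
  obtains c where "v = c *s u"
proof (cases "u$1 = 0")
  case True
  then have "u$2 \<noteq> 0" using assms(2) by (simp add: vec_eq_iff forall_2)
  then have "v = (v$2 / u$2) *s u"
    using True assms(1) by (simp add: vec_eq_iff forall_2 det2_def)
  then show ?thesis ..
next
  case False
  then have "v = (v$1 / u$1) *s u"
    using assms(1) by (simp add: vec_eq_iff forall_2 det2_def nonzero_eq_divide_eq mult.commute)
  then show ?thesis ..
qed

lemma det2_complement:
  assumes "u \<noteq> 0"
  obtains v where "det2 u v \<noteq> 0"
proof (cases "u$1 = 0")
  case True
  then have "det2 u e1 \<noteq> 0" using assms by (simp add: vec_eq_iff forall_2 det2_def axis_def)
  then show ?thesis ..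
next
  case False
  then have "det2 u e2 \<noteq> 0" by (simp add: det2_def axis_def)
  then show ?thesis ..
qed

section \<open>Commutative associative products in dimension two\<close>

locale comm_assoc_product =
  fixes m :: "complex^2 \<Rightarrow> complex^2 \<Rightarrow> complex^2"
  assumes bil: "bilinear_product (*s) m"
    and comm: "m x y = m y x"
    and assoc: "m (m x y) z = m x (m y z)"
begin

lemma lin: "Vector_Spaces.linear (*s) (*s) (m x)"
  using bil unfolding bilinear_product_def by auto

lemma right_simps [simp]:
  "m x (y + z) = m x y + m x z" "m x (c *s y) = c *s m x y"
  "m x 0 = 0" "m x (- y) = - m x y" "m x (y - z) = m x y - m x z"
proof -
  interpret Vector_Spaces.linear "(*s)" "(*s)" "m x" by (rule lin)
  show "m x (y + z) = m x y + m x z" "m x (c *s y) = c *s m x y"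
    "m x 0 = 0" "m x (- y) = - m x y" "m x (y - z) = m x y - m x z"
    by (rule add scale zero neg diff)+
qed

lemma left_simps [simp]:
  "m (y + z) x = m y x + m z x" "m (c *s y) x = c *s m y x"
  "m 0 x = 0" "m (- y) x = - m y x" "m (y - z) x = m y x - m z x"
  by (simp_all add: comm[of _ x])

text \<open>In this order: C x C, the dual numbers C[t]/(t^2), C times a line with zero product, and
  the ideal generated by t in C[t]/(t^3).\<close>

definition normal_basis :: "complex^2 \<Rightarrow> complex^2 \<Rightarrow> bool" where
  "normal_basis u v \<longleftrightarrow> det2 u v \<noteq> 0 \<and>
     (m u u = u \<and> m u v = 0 \<and> m v v = v \<or>
      m u u = u \<and> m u v = v \<and> m v v = 0 \<or>
      m u u = u \<and> m u v = 0 \<and> m v v = 0 \<or>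
      m u u = v \<and> m u v = 0 \<and> m v v = 0)"

text \<open>Multiplication by \<open>e\<close> is a projection fixing \<open>e\<close>, so its other
  eigenvalue is 1, and \<open>e\<close> is a unit, or 0.\<close>

lemma normal_basis_of_idempotent:
  assumes e: "m e e = e" "e \<noteq> 0"
  shows "\<exists>u v. normal_basis u v"
proof -
  obtain y0 where y0: "det2 e y0 \<noteq> 0" using det2_complement e(2) .
  show ?thesis
  proof (cases "m e y0 = y0")
    case True
    obtain p where p: "m y0 y0 = lincomb (*s) e y0 p"
      using surj_lincomb y0 bij_lincomb_vec_iff by metis
    \<comment> \<open>Completing the square: subtracting half of the linear coefficient makes
      \<open>y\<close> square to \<open>c\<close> times the unit.\<close>
    define y where "y = y0 - (p$2 / 2) *s e"
    define c where "c = p$1 + (p$2 / 2)\<^sup>2"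
    have d: "det2 e y \<noteq> 0"
      using y0 by (simp add: y_def det2_def algebra_simps)
    have ey: "m e y = y"
      by (simp add: y_def e True)
    have "m y0 e = y0" using True comm by metis
    then have yy: "m y y = c *s e"
      by (simp add: y_def c_def e True p lincomb_def vec_eq_iff forall_2 power2_eq_square field_simps)
    show ?thesis
    proof (cases "c = 0")
      case True
      then show ?thesis using d ey yy e by (auto simp: normal_basis_def)
    next
      case False
      \<comment> \<open>Scaled so that \<open>z\<close> squares to \<open>e\<close>; then half of
        \<open>e + z\<close> and half of \<open>e - z\<close> are orthogonal idempotents.\<close>
      define z where "z = inverse (csqrt c) *s y"
      have s: "csqrt c * csqrt c = c" "csqrt c \<noteq> 0"
        using False by (simp_all flip: power2_eq_square)
      have ez: "m e z = z" "m z e = z" using ey comm[of y e] by (simp_all add: z_def)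
      have "inverse (csqrt c) * (inverse (csqrt c) * c) = 1"
        using s by (metis inverse_mult_distrib mult.assoc left_inverse False)
      then have zz: "m z z = e" by (simp add: z_def yy vector_smult_assoc)
      have "det2 e z \<noteq> 0" using d s by (simp add: z_def det2_def flip: right_diff_distrib)
      then have "normal_basis ((1/2) *s (e + z)) ((1/2) *s (e - z))"
        by (simp add: normal_basis_def ez zz e) (simp add: vec_eq_iff forall_2 det2_def algebra_simps)
      then show ?thesis by blast
    qed
  next
    case False
    define y where "y = y0 - m e y0"
    have ey: "m e y = 0"
      by (simp add: y_def e flip: assoc)
    have "y \<noteq> 0" using False by (simp add: y_def)
    have d: "det2 e y \<noteq> 0"
    proof
      assume "det2 e y = 0"
      then obtain c where "y = c *s e" using det2_eq_0D e(2) by metis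
      then show False using ey \<open>y \<noteq> 0\<close> e by simp
    qed
    obtain p where p: "m y y = lincomb (*s) e y p"
      using surj_lincomb d bij_lincomb_vec_iff by metis
    \<comment> \<open>Associativity keeps \<open>m y y\<close> in the kernel of multiplication by
      \<open>e\<close>, so it is a multiple of \<open>y\<close>; a nonzero factor is scaled to
      1.\<close>
    have "m e (m y y) = 0" by (simp add: ey flip: assoc)
    then have "p$1 = 0" using e(2) by (simp add: p lincomb_def e ey)
    then have yy: "m y y = p$2 *s y" by (simp add: p lincomb_def)
    show ?thesis
    proof (cases "p$2 = 0")
      case True
      then show ?thesis using d ey yy e by (auto simp: normal_basis_def)
    next
      case False
      have "det2 e (inverse (p$2) *s y) \<noteq> 0"
        using d False by (simp add: det2_def flip: right_diff_distrib)
      then have "normal_basis e (inverse (p$2) *s y)"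
        using False by (simp add: normal_basis_def e ey yy)
      then show ?thesis by blast
    qed
  qed
qed

text \<open>Without nonzero idempotents, a vector \<open>x\<close> with nonzero square is
  independent of \<open>x\<^sup>2\<close>, and any nonzero coefficient of \<open>x\<^sup>3\<close>
  would produce an idempotent. So \<open>x\<close>, \<open>x\<^sup>2\<close> is the nilpotent normal
  form.\<close>

lemma ex_normal_basis:
  assumes "m x0 y0 \<noteq> 0"
  shows "\<exists>u v. normal_basis u v"
proof (rule ccontr)
  assume no: "\<not> ?thesis"
  have idem: "e = 0" if "m e e = e" for e
    using normal_basis_of_idempotent that no by blast
  have idem': "e = 0" if "m e e = c *s e" "c \<noteq> 0" for e c
  proof -
    have "inverse c *s e = 0" by (rule idem) (use that in simp)
    then show ?thesis using that(2) by simp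
  qed
  \<comment> \<open>Polarization: if all squares vanished, commutativity would give
    \<open>2 *s m x0 y0 = 0\<close>.\<close>
  have "\<exists>x. m x x \<noteq> 0"
  proof (rule ccontr)
    assume "\<not> ?thesis"
    then have z: "m x x = 0" for x by blast
    have "m x0 y0 + m y0 x0 = 0" using z[of "x0 + y0"] z[of x0] z[of y0] by (simp add: add.commute)
    then have "2 *s m x0 y0 = 0"
      using comm[of y0 x0] by (simp add: vec_eq_iff)
    then show False using assms by simp
  qed
  then obtain x where x: "m x x \<noteq> 0" by blast
  then have "x \<noteq> 0" by auto
  have d: "det2 x (m x x) \<noteq> 0"
  proof
    assume "det2 x (m x x) = 0"
    then obtain c where c: "m x x = c *s x" using det2_eq_0D \<open>x \<noteq> 0\<close> by metis
    then have "c \<noteq> 0" using x by auto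
    then show False using idem'[OF c] \<open>x \<noteq> 0\<close> by blast
  qed
  obtain p where p: "m x (m x x) = lincomb (*s) x (m x x) p"
    using surj_lincomb d bij_lincomb_vec_iff by metis
  \<comment> \<open>From \<open>x\<^sup>3 = p x + q x\<^sup>2\<close>, multiplication by \<open>x\<^sup>2 - q x\<close> is \<open>p\<close> times the identity, so \<open>p \<noteq> 0\<close> gives a unit.\<close>
  define u where "u = m x x - p$2 *s x"
  have ux: "m u x = p$1 *s x"
    using p comm[of "m x x" x] by (simp add: u_def lincomb_def)
  have uxx: "m u (m x x) = p$1 *s m x x"
    using ux by (simp flip: assoc)
  have "m u z = p$1 *s z" for z
  proof -
    obtain q where "z = lincomb (*s) x (m x x) q"
      using surj_lincomb d bij_lincomb_vec_iff by metis
    then show ?thesis by (simp add: lincomb_def ux uxx vec.scale_left_commute algebra_simps)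
  qed
  then have "p$1 = 0" using idem'[of u "p$1"] ux \<open>x \<noteq> 0\<close> by fastforce
  then have xxx: "m x (m x x) = p$2 *s m x x" using p by (simp add: lincomb_def)
  then have xxxx: "m (m x x) (m x x) = (p$2 * p$2) *s m x x" by (simp add: assoc)
  \<comment> \<open>Otherwise a multiple of \<open>m x x\<close> would be a nonzero
    idempotent.\<close>
  then have "p$2 = 0" using idem'[OF xxxx] x by auto
  then have "normal_basis x (m x x)"
    using d xxx xxxx by (simp add: normal_basis_def)
  then show False using no by blast
qed

end

text \<open>The vectors \<open>u\<close>, \<open>v\<close> are the images of \<open>e1\<close>,
  \<open>e2\<close> under the inverse isomorphism. Hence the witnesses below are new bases of the
  first algebra, in which it acquires the table of the second.\<close>

lemma isomorphic_algebras_table_iff: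
  "isomorphic_algebras (*s) (table d11 d12 d21 d22) (table c11 c12 c21 c22)
      (*s) (table p11 p12 p21 p22) (table q11 q12 q21 q22) \<longleftrightarrow>
   (\<exists>u v. det2 u v \<noteq> 0 \<and>
      table d11 d12 d21 d22 u u = lincomb (*s) u v p11 \<and>
      table d11 d12 d21 d22 u v = lincomb (*s) u v p12 \<and>
      table d11 d12 d21 d22 v u = lincomb (*s) u v p21 \<and>
      table d11 d12 d21 d22 v v = lincomb (*s) u v p22 \<and>
      table c11 c12 c21 c22 u u = lincomb (*s) u v q11 \<and>
      table c11 c12 c21 c22 u v = lincomb (*s) u v q12 \<and>
      table c11 c12 c21 c22 v u = lincomb (*s) u v q21 \<and>
      table c11 c12 c21 c22 v v = lincomb (*s) u v q22)"
    (is "isomorphic_algebras _ ?d ?c _ ?p ?q \<longleftrightarrow> ?R")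
proof
  assume "isomorphic_algebras (*s) ?d ?c (*s) ?p ?q"
  then have "isomorphic_algebras (*s) ?p ?q (*s) ?d ?c"
    by (rule isomorphic_algebras_sym)
  then obtain f where f: "Vector_Spaces.linear (*s) (*s) f" "bij f"
    and h: "\<forall>x y. f (?p x y) = ?d (f x) (f y)" "\<forall>x y. f (?q x y) = ?c (f x) (f y)"
    unfolding isomorphic_algebras_def by blast
  have fl: "f x = lincomb (*s) (f e1) (f e2) x" for x
  proof -
    have "f x = f (x$1 *s e1 + x$2 *s e2)"
      by (rule arg_cong[of _ _ f]) (simp add: vec_eq_iff forall_2 axis_def)
    also have "\<dots> = x$1 *s f e1 + x$2 *s f e2"
      using f(1) by (simp only: Vector_Spaces.linear_iff)
    finally show ?thesis unfolding lincomb_def .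
  qed
  then have "f = lincomb (*s) (f e1) (f e2)" by blast
  then have "det2 (f e1) (f e2) \<noteq> 0" using f(2) bij_lincomb_vec_iff by metis
  moreover have "?d (f x) (f y) = lincomb (*s) (f e1) (f e2) (?p x y)"
    "?c (f x) (f y) = lincomb (*s) (f e1) (f e2) (?q x y)" for x y
    by (simp_all only: h flip: fl)
  from this[of e1 e1] this[of e1 e2] this[of e2 e1] this[of e2 e2]
  have "?d (f e1) (f e1) = lincomb (*s) (f e1) (f e2) p11"
    "?d (f e1) (f e2) = lincomb (*s) (f e1) (f e2) p12"
    "?d (f e2) (f e1) = lincomb (*s) (f e1) (f e2) p21"
    "?d (f e2) (f e2) = lincomb (*s) (f e1) (f e2) p22"
    "?c (f e1) (f e1) = lincomb (*s) (f e1) (f e2) q11"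
    "?c (f e1) (f e2) = lincomb (*s) (f e1) (f e2) q12"
    "?c (f e2) (f e1) = lincomb (*s) (f e1) (f e2) q21"
    "?c (f e2) (f e2) = lincomb (*s) (f e1) (f e2) q22"
    by (simp_all only: table_basis)
  ultimately show ?R by blast
next
  assume ?R
  then obtain u v where uv: "det2 u v \<noteq> 0"
    "?d u u = lincomb (*s) u v p11" "?d u v = lincomb (*s) u v p12"
    "?d v u = lincomb (*s) u v p21" "?d v v = lincomb (*s) u v p22"
    "?c u u = lincomb (*s) u v q11" "?c u v = lincomb (*s) u v q12"
    "?c v u = lincomb (*s) u v q21" "?c v v = lincomb (*s) u v q22"
    by blast
  have "bij (lincomb (*s) u v)" using uv(1) by (simp add: bij_lincomb_vec_iff)
  then show "isomorphic_algebras (*s) ?d ?c (*s) ?p ?q"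
    by (rule isomorphic_algebras_table[OF bilinear_product_table bilinear_product_table _ uv(2-)])
qed

text \<open>For a basis adapted to the first product only; the structure constants of the second
  stay unknown.\<close>

lemma isomorphic_algebras_tableE:
  assumes "bilinear_product scl dot" "bilinear_product scl circ" "bij (lincomb scl u v)"
    "dot u u = lincomb scl u v p11" "dot u v = lincomb scl u v p12"
    "dot v u = lincomb scl u v p21" "dot v v = lincomb scl u v p22"
  obtains q11 q12 q21 q22 where
    "isomorphic_algebras scl dot circ (*s) (table p11 p12 p21 p22) (table q11 q12 q21 q22)"
proof -
  have "\<exists>q. x = lincomb scl u v q" for x
    using surj_lincomb[OF assms(3)] by metis
  then obtain q where "\<And>x. x = lincomb scl u v (q x)" by metis
  then show ?thesis
    by (intro that isomorphic_algebras_table[OF assms])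
qed

lemma vec_2_eq_iff: "x = y \<longleftrightarrow> x$1 = y$1 \<and> x$2 = y$2" for x y :: "'a^2"
  by (simp add: vec_eq_iff forall_2)

lemma e_nth: "e1$1 = 1" "e1$2 = 0" "e2$1 = 0" "e2$2 = 1"
  by (simp_all add: axis_def)

lemma table_nth: "table p11 p12 p21 p22 x y $ i =
    x$1 * y$1 * p11$i + x$1 * y$2 * p12$i + x$2 * y$1 * p21$i + x$2 * y$2 * p22$i"
  by (simp add: table_def)

lemma lincomb_nth: "lincomb (*s) u v p $ i = p$1 * u$i + p$2 * v$i"
  by (simp add: lincomb_def)

lemmas coordinates = vec_2_eq_iff table_nth lincomb_nth det2_def e_nth

section \<open>Reduction of the structure constants\<close>

text \<open>C x C has no nonzero derivations: for both idempotents \<open>e\<close>, the equation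
  \<open>D e = 2 e \<cdot> D e\<close> forces \<open>D e = 0\<close>.\<close>

lemma isomorphic_alg_of_dot_e1_e1_e2_e2:
  assumes "comm_pre_Lie_algebra (*s) (table e1 0 0 e2) (table q11 q12 q21 q22)"
  shows "\<exists>L. isomorphic_algebras (*s) (table e1 0 0 e2) (table q11 q12 q21 q22)
    (*s) (alg_dot L) (alg_circ L)"
proof -
  interpret comm_pre_Lie_algebra "(*s)" "table e1 0 0 e2" "table q11 q12 q21 q22" by fact
  have q: "q11 = 0" "q12 = 0" "q21 = 0" "q22 = 0"
    using Leibniz[of e1 e1 e1] Leibniz[of e2 e1 e1] Leibniz[of e1 e2 e2] Leibniz[of e2 e2 e2]
    by (simp_all add: coordinates)
  have "isomorphic_algebras (*s) (table e1 0 0 e2) (table q11 q12 q21 q22)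
    (*s) (alg_dot C09) (alg_circ C09)"
    unfolding alg_dot.simps alg_circ.simps isomorphic_algebras_table_iff
    by (rule exI[of _ e1], rule exI[of _ e2]) (simp add: q coordinates)
  then show ?thesis by (rule exI[of _ "C09"])
qed

text \<open>A derivation kills the unit \<open>e1\<close> and maps the nilpotent \<open>e2\<close>
  to a multiple of itself. Two scalars remain, and the pre-Lie identity makes their product
  zero.\<close>

lemma isomorphic_alg_of_dot_e1_e2_e2_0:
  assumes "comm_pre_Lie_algebra (*s) (table e1 e2 e2 0) (table q11 q12 q21 q22)"
  shows "\<exists>L. isomorphic_algebras (*s) (table e1 e2 e2 0) (table q11 q12 q21 q22)
    (*s) (alg_dot L) (alg_circ L)"
proof -
  interpret comm_pre_Lie_algebra "(*s)" "table e1 e2 e2 0" "table q11 q12 q21 q22" by fact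
  have q: "q11 = 0" "q21 = 0" "q12$1 = 0" "q22$1 = 0"
    using Leibniz[of e1 e1 e1] Leibniz[of e2 e1 e1] Leibniz[of e1 e2 e2] Leibniz[of e2 e2 e2]
    by (simp_all add: coordinates)
  have p: "q12$2 = 0 \<or> q22$2 = 0"
    using pre_Lie[of e1 e2 e2] by (auto simp: coordinates q)
  show ?thesis
  proof (cases "q22$2 = 0")
    case True
    have "isomorphic_algebras (*s) (table e1 e2 e2 0) (table q11 q12 q21 q22)
      (*s) (alg_dot (C10 (q12$2))) (alg_circ (C10 (q12$2)))"
      unfolding alg_dot.simps alg_circ.simps isomorphic_algebras_table_iff
      by (rule exI[of _ e1], rule exI[of _ e2]) (simp add: q True coordinates)
    then show ?thesis by (rule exI[of _ "C10 (q12$2)"])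
  next
    case False
    have "isomorphic_algebras (*s) (table e1 e2 e2 0) (table q11 q12 q21 q22)
      (*s) (alg_dot C11) (alg_circ C11)"
      unfolding alg_dot.simps alg_circ.simps isomorphic_algebras_table_iff
      by (rule exI[of _ e1], rule exI[of _ "inverse (q22$2) *s e2"])
        (use q p False in \<open>simp add: coordinates\<close>)
    then show ?thesis by (rule exI[of _ "C11"])
  qed
qed

text \<open>As for the dual numbers: a derivation kills the idempotent \<open>e1\<close> and
  preserves the annihilator, the line of \<open>e2\<close>.\<close>

lemma isomorphic_alg_of_dot_e1_0_0_0:
  assumes "comm_pre_Lie_algebra (*s) (table e1 0 0 0) (table q11 q12 q21 q22)"
  shows "\<exists>L. isomorphic_algebras (*s) (table e1 0 0 0) (table q11 q12 q21 q22)
    (*s) (alg_dot L) (alg_circ L)"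
proof -
  interpret comm_pre_Lie_algebra "(*s)" "table e1 0 0 0" "table q11 q12 q21 q22" by fact
  have q: "q11 = 0" "q21 = 0" "q12$1 = 0" "q22$1 = 0"
    using Leibniz[of e1 e1 e1] Leibniz[of e2 e1 e1] Leibniz[of e1 e1 e2] Leibniz[of e2 e1 e2]
    by (simp_all add: coordinates)
  have p: "q12$2 = 0 \<or> q22$2 = 0"
    using pre_Lie[of e1 e2 e2] by (auto simp: coordinates q)
  show ?thesis
  proof (cases "q22$2 = 0")
    case True
    have "isomorphic_algebras (*s) (table e1 0 0 0) (table q11 q12 q21 q22)
      (*s) (alg_dot (C12 (q12$2))) (alg_circ (C12 (q12$2)))"
      unfolding alg_dot.simps alg_circ.simps isomorphic_algebras_table_iff
      by (rule exI[of _ e1], rule exI[of _ e2]) (simp add: q True coordinates)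
    then show ?thesis by (rule exI[of _ "C12 (q12$2)"])
  next
    case False
    have "isomorphic_algebras (*s) (table e1 0 0 0) (table q11 q12 q21 q22)
      (*s) (alg_dot C13) (alg_circ C13)"
      unfolding alg_dot.simps alg_circ.simps isomorphic_algebras_table_iff
      by (rule exI[of _ e1], rule exI[of _ "inverse (q22$2) *s e2"])
        (use q p False in \<open>simp add: coordinates\<close>)
    then show ?thesis by (rule exI[of _ "C13"])
  qed
qed

text \<open>As \<open>e2\<close> is the square of \<open>e1\<close>, a derivation is determined by
  its value at \<open>e1\<close>. So \<open>e1 \<circ> e1\<close> and \<open>e2 \<circ> e1\<close>
  determine the whole table.\<close>

lemma isomorphic_alg_of_dot_e2_0_0_0:
  assumes "comm_pre_Lie_algebra (*s) (table e2 0 0 0) (table q11 q12 q21 q22)"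
  shows "\<exists>L. isomorphic_algebras (*s) (table e2 0 0 0) (table q11 q12 q21 q22)
    (*s) (alg_dot L) (alg_circ L)"
proof -
  interpret comm_pre_Lie_algebra "(*s)" "table e2 0 0 0" "table q11 q12 q21 q22" by fact
  define a b c d where abcd: "a = q11$1" "b = q11$2" "c = q21$1" "d = q21$2"
  have q: "q11$1 = a" "q11$2 = b" "q21$1 = c" "q21$2 = d"
    "q12$1 = 0" "q12$2 = 2 * a" "q22$1 = 0" "q22$2 = 2 * c"
    using Leibniz[of e1 e1 e1] Leibniz[of e2 e1 e1] by (simp_all add: coordinates abcd)
  have p: "c * (a - d) = 0" "d * (a - d) = 0"
    using pre_Lie[of e1 e2 e1] by (simp_all add: coordinates q algebra_simps)
  consider "c = 0" "d = 0" "a = 0" | "c = 0" "d = 0" "a \<noteq> 0" | "c = 0" "d = a" "a \<noteq> 0" | "c \<noteq> 0" "d = a"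
    using p by auto
  then show ?thesis
  proof cases
    case 1
    have "isomorphic_algebras (*s) (table e2 0 0 0) (table q11 q12 q21 q22)
      (*s) (alg_dot (C17 b)) (alg_circ (C17 b))"
      unfolding alg_dot.simps alg_circ.simps isomorphic_algebras_table_iff
      by (rule exI[of _ e1], rule exI[of _ e2]) (simp add: q 1 coordinates)
    then show ?thesis by (rule exI[of _ "C17 b"])
  next
    case 2
    \<comment> \<open>Scaling \<open>e1\<close> by \<open>1 / a\<close> normalizes \<open>a\<close>
      to 1, the added multiple of \<open>e2\<close> kills \<open>b\<close>, and the second vector is
      the square of the first. The next case does the same.\<close>
    have "isomorphic_algebras (*s) (table e2 0 0 0) (table q11 q12 q21 q22)
      (*s) (alg_dot C14) (alg_circ C14)"
      unfolding alg_dot.simps alg_circ.simps isomorphic_algebras_table_iff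
      by (rule exI[of _ "vector [1 / a, - b / a^2]"], rule exI[of _ "vector [0, 1 / a^2]"])
        (use 2 in \<open>simp add: q coordinates field_simps power2_eq_square\<close>)
    then show ?thesis by (rule exI[of _ "C14"])
  next
    case 3
    have "isomorphic_algebras (*s) (table e2 0 0 0) (table q11 q12 q21 q22)
      (*s) (alg_dot C16) (alg_circ C16)"
      unfolding alg_dot.simps alg_circ.simps isomorphic_algebras_table_iff
      by (rule exI[of _ "vector [1 / a, - b / (2 * a^2)]"], rule exI[of _ "vector [0, 1 / a^2]"])
        (use 3 in \<open>simp add: q coordinates field_simps power2_eq_square\<close>)
    then show ?thesis by (rule exI[of _ "C16"])
  next
    case 4
    \<comment> \<open>Thus \<open>\<alpha>\<^sup>2 = (a\<^sup>2 - b * c) / c\<close>; other choices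
      of the square roots change at most the sign of \<alpha>.\<close>
    define r \<alpha> where r\<alpha>: "r = inverse (csqrt c)" "\<alpha> = csqrt (a^2 - b * c) * r"
    have "csqrt c * csqrt c = c" "csqrt c \<noteq> 0"
      using 4 by (simp_all flip: power2_eq_square)
    then have r: "c * r * r = 1" "r \<noteq> 0"
      using 4 unfolding r\<alpha> by (simp_all add: field_simps)
    have "csqrt (a^2 - b * c) * csqrt (a^2 - b * c) = a^2 - b * c"
      by (simp flip: power2_eq_square)
    then have \<alpha>: "\<alpha> * \<alpha> = (a^2 - b * c) * r * r" unfolding r\<alpha> by algebra
    \<comment> \<open>The new basis \<open>r e1 + v e2\<close>, \<open>r\<^sup>2 e2\<close>: \<open>r\<close> normalizes \<open>c\<close> to \<open>1\<close>, and killing \<open>b\<close> is a quadratic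
      equation for \<open>v\<close>, with discriminant proportional to \<open>a\<^sup>2 - b c\<close>.\<close>
    define v where "v = (\<alpha> - a * r) * r * r"
    have v: "a * r + c * v = \<alpha>"  using r unfolding v_def by algebra
    have v': "b * r^2 + 3 * a * r * v + 2 * c * v^2 = \<alpha> * v" using r \<alpha> unfolding v_def by algebra
    have E: "r * r * a + v * r * c = \<alpha> * r"
      "3 * (a * (r * v)) + r * r * b + v * v * (2 * c) = \<alpha> * v"
      "r * (r * r) * (2 * a) + v * (r * r) * (2 * c) = 2 * \<alpha> * (r * r)"
      "r * r * c = 1" "r * r * r * a + r * r * v * (2 * c) = v + \<alpha> * (r * r)"
      "r * r * (r * r) * c = r * r"
      using r v v' by algebra+
    have "isomorphic_algebras (*s) (table e2 0 0 0) (table q11 q12 q21 q22)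
      (*s) (alg_dot (C15 \<alpha>)) (alg_circ (C15 \<alpha>))"
      unfolding alg_dot.simps alg_circ.simps isomorphic_algebras_table_iff
      by (rule exI[of _ "vector [r, v]"], rule exI[of _ "vector [0, r * r]"])
        (use r(2) E in \<open>simp add: q 4(2) coordinates\<close>)
    then show ?thesis by (rule exI[of _ "C15 \<alpha>"])
  qed
qed

text \<open>Here \<open>e1\<close>, \<open>e2\<close> play the roles of \<open>h\<close>,
  \<open>w\<close>. If \<open>e2 \<circ> e2\<close> has a nonzero \<open>e1\<close>-coordinate,
  everything reduces to \<open>C08\<close>. Otherwise \<open>e2\<close> spans an ideal with zero
  product, and it remains to remove or normalize the \<open>e2\<close>-coordinate of
  \<open>e1 \<circ> e1\<close>.\<close>

lemma isomorphic_alg_of_commutator_e2: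
  assumes "comm_pre_Lie_algebra (*s) (table 0 0 0 0) (table q11 q12 q21 q22)"
    and comm: "q12 = q21 + e2"
  shows "\<exists>L. isomorphic_algebras (*s) (table 0 0 0 0) (table q11 q12 q21 q22)
    (*s) (alg_dot L) (alg_circ L)"
proof -
  interpret comm_pre_Lie_algebra "(*s)" "table 0 0 0 0" "table q11 q12 q21 q22" by fact
  define a b c d s t where abcd: "a = q11$1" "b = q11$2" "c = q21$1" "d = q21$2" "s = q22$1" "t = q22$2"
  have q: "q11$1 = a" "q11$2 = b" "q21$1 = c" "q21$2 = d"
    "q12$1 = c" "q12$2 = d + 1" "q22$1 = s" "q22$2 = t"
    using comm by (simp_all add: coordinates abcd)
  have eq1: "(d + 1) * c = 2 * (c * d) - b * s" and eq2: "- (d * d) = c * b + (- (a * d) - b * t)"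
    and eq3: "2 * (s * (d + 1)) - d * s = s * a + (t * c - c * c)"
    and eq4: "(d + 1) * t - d * t = s * b - c * d"
    using pre_Lie[of e1 e2 e1] pre_Lie[of e1 e2 e2] by (simp_all add: coordinates q)
  \<comment> \<open>The trace \<open>c + t\<close> of left multiplication by \<open>e2\<close>
    vanishes, as for any commutator.\<close>
  have ct: "c = - t" using eq1 eq4 by algebra
  \<comment> \<open>the determinant of left multiplication by \<open>e2\<close>, which is nilpotent as it is \<open>[L\<^sub>1, L\<^sub>2] = L\<^sub>2\<close>\<close>
  have t: "t * t + s * d = 0"
  proof -
    have "2 * (t * t + s * d) = 0" using eq2 eq3 eq4 unfolding ct by algebra
    then show ?thesis by (metis mult_eq_0_iff zero_neq_numeral)
  qed
  show ?thesis
  proof (cases "s = 0")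
    case False
    \<comment> \<open>With \<open>h = e1 + \<tau> e2\<close> and \<open>w = e2\<close> the table is \<open>h \<circ> h = 2 h\<close>, \<open>h \<circ> w = w\<close>, \<open>w \<circ> h = 0\<close>, \<open>w \<circ> w = s h\<close>;
      \<open>C08\<close> has this form in the basis \<open>h = 2 e2\<close>, \<open>\<kappa> w = e2 - e1 / 2\<close>.\<close>
    define \<tau> \<kappa> where \<tau>\<kappa>: "\<tau> = t / s" "\<kappa> = csqrt (- 1 / (4 * s))"
    have \<tau>: "t = \<tau> * s" using False by (simp add: \<tau>\<kappa>)
    have "s * (d + \<tau> * \<tau> * s) = 0" using t unfolding \<tau> by algebra
    then have d: "d = - (\<tau> * \<tau> * s)" using False by (simp add: eq_neg_iff_add_eq_0)
    have "s * (a - (2 + \<tau> * \<tau> * s)) = 0" using eq3 unfolding \<tau> d ct by algebra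
    then have a: "a = 2 + \<tau> * \<tau> * s" using False by simp
    have "s * (b - (\<tau> + \<tau> * \<tau> * \<tau> * s)) = 0" using eq4 unfolding \<tau> d ct by algebra
    then have b: "b = \<tau> + \<tau> * \<tau> * \<tau> * s" using False by simp
    have "\<kappa> * \<kappa> = - 1 / (4 * s)" by (simp add: \<tau>\<kappa> flip: power2_eq_square)
    then have \<kappa>: "4 * \<kappa> * \<kappa> * s = - 1" "\<kappa> \<noteq> 0" using False by (auto simp: field_simps)
    have "isomorphic_algebras (*s) (table 0 0 0 0) (table q11 q12 q21 q22)
      (*s) (alg_dot C08) (alg_circ C08)"
      unfolding alg_dot.simps alg_circ.simps isomorphic_algebras_table_iff
      by (rule exI[of _ "vector [1, \<tau> - 2 * \<kappa>]"], rule exI[of _ "vector [1/2, \<tau>/2]"])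
        (simp add: q coordinates a b ct \<tau> d \<kappa> field_simps; intro conjI; use \<kappa>(1) in algebra)
    then show ?thesis by (rule exI[of _ "C08"])
  next
    case True
    then have 0: "s = 0" "t = 0" "c = 0" using t ct by auto
    then have "d = 0 \<or> d = a" using eq2 by auto
    \<comment> \<open>Adding a multiple of \<open>e2\<close> to \<open>e1\<close> changes
      \<open>b\<close> by a multiple of \<open>a - 1\<close> if \<open>d = 0\<close>, and of
      \<open>a + 1\<close> if \<open>d = a\<close>. At \<open>a = 1\<close> and
      \<open>a = - 1\<close> respectively, a nonzero \<open>b\<close> is absorbed by rescaling
      \<open>e2\<close> instead.\<close>
    then consider "d = 0" "a = 0" | "d = 0" "a \<noteq> 0" "a \<noteq> 1" | "d = 0" "a = 1" "b = 0"
      | "d = 0" "a = 1" "b \<noteq> 0" | "d = a" "a \<noteq> 0" "a \<noteq> - 1" | "d = a" "a = - 1" "b = 0"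
      | "d = a" "a = - 1" "b \<noteq> 0"
      by blast
    then show ?thesis
    proof cases
      case 1
      have "isomorphic_algebras (*s) (table 0 0 0 0) (table q11 q12 q21 q22)
        (*s) (alg_dot C04) (alg_circ C04)"
        unfolding alg_dot.simps alg_circ.simps isomorphic_algebras_table_iff
        by (rule exI[of _ e2], rule exI[of _ "vector [1, - b]"]) (simp add: q 0 1 coordinates)
      then show ?thesis by (rule exI[of _ "C04"])
    next
      case 2
      define k r where kr: "k = b / (a - 1)" "r = inverse a"
      have r: "a * r = 1" "r \<noteq> 0" using 2 by (simp_all add: kr)
      have k: "b = k * (a - 1)" using 2 by (simp add: kr)
      have E: "r * (r * a) = r" "r * (r * b) + r * (k * r) = k * r"
        using r k by algebra+
      have "isomorphic_algebras (*s) (table 0 0 0 0) (table q11 q12 q21 q22)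
        (*s) (alg_dot (C05 r)) (alg_circ (C05 r))"
        unfolding alg_dot.simps alg_circ.simps isomorphic_algebras_table_iff
        by (rule exI[of _ "vector [r, k * r]"], rule exI[of _ e2])
          (use r(2) E in \<open>simp add: q 0 2(1) coordinates mult.assoc\<close>)
      then show ?thesis by (rule exI[of _ "C05 r"])
    next
      case 3
      have "isomorphic_algebras (*s) (table 0 0 0 0) (table q11 q12 q21 q22)
        (*s) (alg_dot (C05 1)) (alg_circ (C05 1))"
        unfolding alg_dot.simps alg_circ.simps isomorphic_algebras_table_iff
        by (rule exI[of _ e1], rule exI[of _ e2]) (simp add: q 0 3 coordinates)
      then show ?thesis by (rule exI[of _ "C05 1"])
    next
      case 4
      have "isomorphic_algebras (*s) (table 0 0 0 0) (table q11 q12 q21 q22)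
        (*s) (alg_dot C02) (alg_circ C02)"
        unfolding alg_dot.simps alg_circ.simps isomorphic_algebras_table_iff
        by (rule exI[of _ e1], rule exI[of _ "b *s e2"]) (simp add: q 0 4 coordinates)
      then show ?thesis by (rule exI[of _ "C02"])
    next
      case 5
      define k r where kr: "k = b / (a + 1)" "r = inverse a"
      have r: "a * r = 1" "r * a = 1" "r \<noteq> 0" using 5 by (simp_all add: kr)
      have "a + 1 \<noteq> 0" using 5(3) by (simp add: eq_neg_iff_add_eq_0)
      then have k: "b = k * (a + 1)" by (simp add: kr)
      have E: "r * (r * a) = r"
        "r * (r * b) - (r * (k * r) * (a + 1) + k * r * r * a) = - (k * r)"
        using r k by algebra+
      have "isomorphic_algebras (*s) (table 0 0 0 0) (table q11 q12 q21 q22)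
        (*s) (alg_dot (C06 (1 + r))) (alg_circ (C06 (1 + r)))"
        unfolding alg_dot.simps alg_circ.simps isomorphic_algebras_table_iff
        by (rule exI[of _ "vector [r, - (k * r)]"], rule exI[of _ e2])
          (use r E in \<open>simp add: q 0 5(1) coordinates algebra_simps\<close>)
      then show ?thesis by (rule exI[of _ "C06 (1 + r)"])
    next
      case 6
      have "isomorphic_algebras (*s) (table 0 0 0 0) (table q11 q12 q21 q22)
        (*s) (alg_dot (C06 0)) (alg_circ (C06 0))"
        unfolding alg_dot.simps alg_circ.simps isomorphic_algebras_table_iff
        by (rule exI[of _ "- e1"], rule exI[of _ e2]) (simp add: q 0 6 coordinates)
      then show ?thesis by (rule exI[of _ "C06 0"])
    next
      case 7
      have "isomorphic_algebras (*s) (table 0 0 0 0) (table q11 q12 q21 q22)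
        (*s) (alg_dot C01) (alg_circ C01)"
        unfolding alg_dot.simps alg_circ.simps isomorphic_algebras_table_iff
        by (rule exI[of _ "- e1"], rule exI[of _ "b *s e2"]) (simp add: q 0 7 coordinates)
      then show ?thesis by (rule exI[of _ "C01"])
    qed
  qed
qed

section \<open>From arbitrary algebras to the reduced tables\<close>

lemma lincomb_e [simp]:
  "lincomb (*s) u v e1 = u" "lincomb (*s) u v e2 = v" "lincomb (*s) u v 0 = 0"
  by (simp_all add: lincomb_def axis_def)

lemma isomorphic_alg_of_dot_nonzero:
  fixes dot circ :: "complex^2 \<Rightarrow> complex^2 \<Rightarrow> complex^2"
  assumes "comm_pre_Lie_algebra (*s) dot circ" "dot x0 y0 \<noteq> 0"
  shows "\<exists>L. isomorphic_algebras (*s) dot circ (*s) (alg_dot L) (alg_circ L)"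
proof -
  interpret comm_pre_Lie_algebra "(*s)" dot circ by fact
  interpret comm_assoc_product dot
    by unfold_locales (fact dot_bilinear dot_commute dot_assoc)+
  obtain u v where uv: "normal_basis u v" using ex_normal_basis[OF assms(2)] by blast
  then have bij: "bij (lincomb (*s) u v)"
    by (simp add: normal_basis_def bij_lincomb_vec_iff)
  \<comment> \<open>Common to the four cases: pass to the table in the basis \<open>u\<close>,
    \<open>v\<close>, transport the identities, and apply the reduction for that table.\<close>
  have step: ?thesis
    if p: "dot u u = lincomb (*s) u v p11" "dot u v = lincomb (*s) u v p12"
        "dot v v = lincomb (*s) u v p22"
      and L: "\<And>q11 q12 q21 q22.
        comm_pre_Lie_algebra (*s) (table p11 p12 p12 p22) (table q11 q12 q21 q22) \<Longrightarrow>
        \<exists>L. isomorphic_algebras (*s) (table p11 p12 p12 p22) (table q11 q12 q21 q22)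
          (*s) (alg_dot L) (alg_circ L)" for p11 p12 p22
  proof -
    have "dot v u = lincomb (*s) u v p12" using p(2) comm by metis
    from isomorphic_algebras_tableE[OF dot_bilinear circ_bilinear bij p(1,2) this p(3)]
    obtain q11 q12 q21 q22 where iso: "isomorphic_algebras (*s) dot circ
        (*s) (table p11 p12 p12 p22) (table q11 q12 q21 q22)"
      by blast
    have "comm_pre_Lie_algebra (*s) (table p11 p12 p12 p22) (table q11 q12 q21 q22)"
      using assms(1) iso bilinear_product_table bilinear_product_table
      by (rule comm_pre_Lie_algebra_isomorphic)
    from L[OF this] obtain L where
      "isomorphic_algebras (*s) (table p11 p12 p12 p22) (table q11 q12 q21 q22)
        (*s) (alg_dot L) (alg_circ L)" ..
    then show ?thesis by (intro exI[of _ L] isomorphic_algebras_trans[OF iso])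
  qed
  consider "dot u u = u" "dot u v = 0" "dot v v = v" | "dot u u = u" "dot u v = v" "dot v v = 0"
    | "dot u u = u" "dot u v = 0" "dot v v = 0" | "dot u u = v" "dot u v = 0" "dot v v = 0"
    using uv unfolding normal_basis_def by blast
  then show ?thesis
  proof cases
    case 1
    show ?thesis
      by (rule step[OF _ _ _ isomorphic_alg_of_dot_e1_e1_e2_e2]) (simp_all add: 1)
  next
    case 2
    show ?thesis
      by (rule step[OF _ _ _ isomorphic_alg_of_dot_e1_e2_e2_0]) (simp_all add: 2)
  next
    case 3
    show ?thesis
      by (rule step[OF _ _ _ isomorphic_alg_of_dot_e1_0_0_0]) (simp_all add: 3)
  next
    case 4
    show ?thesis
      by (rule step[OF _ _ _ isomorphic_alg_of_dot_e2_0_0_0]) (simp_all add: 4)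
  qed
qed

lemma table_0: "table 0 0 0 0 = (\<lambda>x y. 0)"
  by (simp add: fun_eq_iff table_def)

lemma isomorphic_alg_of_circ_commute:
  fixes circ :: "complex^2 \<Rightarrow> complex^2 \<Rightarrow> complex^2"
  assumes "comm_pre_Lie_algebra (*s) (\<lambda>x y. 0) circ" "circ x0 y0 \<noteq> 0"
    and comm: "\<And>x y. circ x y = circ y x"
  shows "\<exists>L. isomorphic_algebras (*s) (\<lambda>x y. 0) circ (*s) (alg_dot L) (alg_circ L)"
proof -
  interpret comm_pre_Lie_algebra "(*s)" "\<lambda>x y. 0" circ by fact
  interpret comm_assoc_product circ
  proof
    \<comment> \<open>By commutativity the left side of the pre-Lie identity vanishes, so left
      multiplications commute, which amounts to associativity.\<close>
    show "circ (circ x y) z = circ x (circ y z)" for x y z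
      using pre_Lie[of x z y] comm by simp
  qed (fact circ_bilinear comm)+
  obtain u v where uv: "normal_basis u v" using ex_normal_basis[OF assms(2)] by blast
  then have bij: "bij (lincomb (*s) u v)"
    by (simp add: normal_basis_def bij_lincomb_vec_iff)
  note iso = isomorphic_algebras_table[OF dot_bilinear circ_bilinear bij,
      of 0 0 0 0, unfolded table_0, simplified]
  consider "circ u u = u" "circ u v = 0" "circ v v = v" | "circ u u = u" "circ u v = v" "circ v v = 0"
    | "circ u u = u" "circ u v = 0" "circ v v = 0" | "circ u u = v" "circ u v = 0" "circ v v = 0"
    using uv unfolding normal_basis_def by blast
  then show ?thesis
  proof cases
    case 1
    then have "isomorphic_algebras (*s) (\<lambda>x y. 0) circ (*s) (alg_dot C07) (alg_circ C07)"
      unfolding alg_dot.simps alg_circ.simps table_0 by (intro iso) (simp_all add: comm[of v u])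
    then show ?thesis by (rule exI[of _ "C07"])
  next
    case 2
    then have "isomorphic_algebras (*s) (\<lambda>x y. 0) circ (*s) (alg_dot (C06 1)) (alg_circ (C06 1))"
      unfolding alg_dot.simps alg_circ.simps table_0 by (intro iso) (simp_all add: comm[of v u])
    then show ?thesis by (rule exI[of _ "C06 1"])
  next
    case 3
    then have "isomorphic_algebras (*s) (\<lambda>x y. 0) circ (*s) (alg_dot (C05 0)) (alg_circ (C05 0))"
      unfolding alg_dot.simps alg_circ.simps table_0 by (intro iso) (simp_all add: comm[of v u])
    then show ?thesis by (rule exI[of _ "C05 0"])
  next
    case 4
    then have "isomorphic_algebras (*s) (\<lambda>x y. 0) circ (*s) (alg_dot C03) (alg_circ C03)"
      unfolding alg_dot.simps alg_circ.simps table_0 by (intro iso) (simp_all add: comm[of v u])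
    then show ?thesis by (rule exI[of _ "C03"])
  qed
qed

text \<open>In dimension two an alternating bilinear map is the determinant times a fixed vector
  \<open>w\<close>. For the commutator, any \<open>h\<close> with \<open>det2 h w = 1\<close> then
  satisfies \<open>[h, w] = w\<close>.\<close>

lemma isomorphic_alg_of_circ_not_commute:
  fixes circ :: "complex^2 \<Rightarrow> complex^2 \<Rightarrow> complex^2"
  assumes "comm_pre_Lie_algebra (*s) (\<lambda>x y. 0) circ" "circ x0 y0 \<noteq> circ y0 x0"
  shows "\<exists>L. isomorphic_algebras (*s) (\<lambda>x y. 0) circ (*s) (alg_dot L) (alg_circ L)"
proof -
  interpret comm_pre_Lie_algebra "(*s)" "\<lambda>x y. 0" circ by fact
  define w where "w = circ e1 e2 - circ e2 e1"
  have bracket: "circ x y - circ y x = det2 x y *s w" for x y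
  proof -
    have "x = lincomb (*s) e1 e2 x" "y = lincomb (*s) e1 e2 y"
      by (simp_all add: lincomb_def vec_eq_iff forall_2 axis_def)
    then have "circ x y - circ y x =
      circ (lincomb (*s) e1 e2 x) (lincomb (*s) e1 e2 y) - circ (lincomb (*s) e1 e2 y) (lincomb (*s) e1 e2 x)"
      by metis
    also have "\<dots> = det2 x y *s w"
      unfolding bilinear_product_lincomb[OF circ_bilinear]
      by (simp add: w_def det2_def vec_eq_iff algebra_simps)
    finally show ?thesis .
  qed
  have "w \<noteq> 0" using bracket[of x0 y0] assms(2) by auto
  then obtain h0 where h0: "det2 w h0 \<noteq> 0" using det2_complement by blast
  define h where "h = - inverse (det2 w h0) *s h0"
  have "det2 h w = 1"
  proof -
    have "det2 h w = inverse (det2 w h0) * det2 w h0" by (simp add: h_def det2_def algebra_simps)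
    then show ?thesis using h0 by simp
  qed
  then have hw: "circ h w = circ w h + w" using bracket[of h w] by (simp add: algebra_simps)
  have bij: "bij (lincomb (*s) h w)" using \<open>det2 h w = 1\<close> by (simp add: bij_lincomb_vec_iff)
  obtain q11 q21 q22 where q: "circ h h = lincomb (*s) h w q11" "circ w h = lincomb (*s) h w q21"
    "circ w w = lincomb (*s) h w q22"
    using surj_lincomb[OF bij] by metis
  have "circ h w = lincomb (*s) h w (q21 + e2)"
    unfolding hw q by (simp add: lincomb_def vec_eq_iff forall_2 axis_def algebra_simps)
  from isomorphic_algebras_table[OF dot_bilinear circ_bilinear bij _ _ _ _ q(1) this q(2,3)]
  have iso: "isomorphic_algebras (*s) (\<lambda>x y. 0) circ (*s) (table 0 0 0 0) (table q11 (q21 + e2) q21 q22)"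
    by simp
  have "comm_pre_Lie_algebra (*s) (table 0 0 0 0) (table q11 (q21 + e2) q21 q22)"
    using assms(1) iso bilinear_product_table bilinear_product_table
    by (rule comm_pre_Lie_algebra_isomorphic)
  from isomorphic_alg_of_commutator_e2[OF this refl] obtain L where
    "isomorphic_algebras (*s) (table 0 0 0 0) (table q11 (q21 + e2) q21 q22)
      (*s) (alg_dot L) (alg_circ L)" ..
  then show ?thesis by (intro exI[of _ L] isomorphic_algebras_trans[OF iso])
qed

lemma ex_isomorphic_alg:
  fixes scl :: "complex \<Rightarrow> 'a::ab_group_add \<Rightarrow> 'a"
  assumes C: "comm_pre_Lie_algebra scl dot circ"
    and dim: "vector_space.dim scl (UNIV :: 'a set) = 2"
    and nz: "nonzero_products dot circ"
  shows "\<exists>L. isomorphic_algebras scl dot circ (*s) (alg_dot L) (alg_circ L)"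
proof -
  interpret comm_pre_Lie_algebra scl dot circ by fact
  obtain u v where bij: "bij (lincomb scl u v)"
    using dim_2_basis[OF vector_space_axioms dim] .
  obtain p11 p12 p21 p22 where
    "dot u u = lincomb scl u v p11" "dot u v = lincomb scl u v p12"
    "dot v u = lincomb scl u v p21" "dot v v = lincomb scl u v p22"
    using surj_lincomb[OF bij] by metis
  from isomorphic_algebras_tableE[OF dot_bilinear circ_bilinear bij this]
  obtain q11 q12 q21 q22 where iso: "isomorphic_algebras scl dot circ
      (*s) (table p11 p12 p21 p22) (table q11 q12 q21 q22)" (is "isomorphic_algebras _ _ _ _ ?p ?q")
    by blast
  have V: "comm_pre_Lie_algebra (*s) ?p ?q"
    using C iso bilinear_product_table bilinear_product_table
    by (rule comm_pre_Lie_algebra_isomorphic)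
  have "\<exists>L. isomorphic_algebras (*s) ?p ?q (*s) (alg_dot L) (alg_circ L)"
  proof (cases "\<forall>x y. ?p x y = 0")
    case False
    then show ?thesis using isomorphic_alg_of_dot_nonzero[OF V] by blast
  next
    case True
    then have p0: "?p = (\<lambda>x y. 0)" by blast
    \<comment> \<open>If both tables were zero, the isomorphism would make both original products
      zero.\<close>
    have "\<exists>x y. ?q x y \<noteq> 0"
    proof (rule ccontr)
      assume "\<not> ?thesis"
      then have q0: "?q = (\<lambda>x y. 0)" by blast
      obtain f :: "complex^2 \<Rightarrow> 'a" where "Vector_Spaces.linear (*s) scl f" "bij f"
        and f: "\<forall>x y. f 0 = dot (f x) (f y)" "\<forall>x y. f 0 = circ (f x) (f y)"
        using isomorphic_algebras_sym[OF iso] unfolding isomorphic_algebras_def p0 q0 by blast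
      interpret f: Vector_Spaces.linear "(*s)" scl f by fact
      have "dot a b = 0" "circ a b = 0" for a b
        using f \<open>bij f\<close> f.zero by (metis bij_is_surj surjD)+
      then show False using nz unfolding nonzero_products_def by blast
    qed
    then obtain x y where q: "?q x y \<noteq> 0" by blast
    show ?thesis
    proof (cases "\<forall>x y. ?q x y = ?q y x")
      case True
      then show ?thesis
        unfolding p0 by (intro isomorphic_alg_of_circ_commute[OF V[unfolded p0] q]) blast
    next
      case False
      then obtain x y where "?q x y \<noteq> ?q y x" by blast
      then show ?thesis
        unfolding p0 by (rule isomorphic_alg_of_circ_not_commute[OF V[unfolded p0]])
    qed
  qed
  then obtain L where "isomorphic_algebras (*s) ?p ?q (*s) (alg_dot L) (alg_circ L)" ..
  then show ?thesis by (intro exI[of _ L] isomorphic_algebras_trans[OF iso])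
qed

section \<open>Isomorphisms between the listed algebras\<close>

lemma isomorphic_alg_C15_minus:
  "isomorphic_algebras (*s) (alg_dot (C15 \<alpha>)) (alg_circ (C15 \<alpha>))
    (*s) (alg_dot (C15 (- \<alpha>))) (alg_circ (C15 (- \<alpha>)))"
  unfolding alg_dot.simps alg_circ.simps isomorphic_algebras_table_iff
  by (rule exI[of _ "- e1"], rule exI[of _ e2]) (simp add: coordinates)

lemma isomorphic_alg_refl:
  "isomorphic_algebras (*s) (alg_dot L) (alg_circ L) (*s) (alg_dot L) (alg_circ L)"
  unfolding isomorphic_algebras_def
  by (intro exI[of _ id]) (simp add: Vector_Spaces.linear_iff vec.vector_space_axioms)

section \<open>Invariants of the commutative product\<close>

definition unital :: "('b \<Rightarrow> 'b \<Rightarrow> 'b) \<Rightarrow> bool" where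
  "unital m \<longleftrightarrow> (\<exists>e. \<forall>x. m e x = x)"

definition square_zero_free :: "('b::zero \<Rightarrow> 'b \<Rightarrow> 'b) \<Rightarrow> bool" where
  "square_zero_free m \<longleftrightarrow> (\<forall>x. m x x = 0 \<longrightarrow> x = 0)"

definition has_idempotent :: "('b::zero \<Rightarrow> 'b \<Rightarrow> 'b) \<Rightarrow> bool" where
  "has_idempotent m \<longleftrightarrow> (\<exists>x. x \<noteq> 0 \<and> m x x = x)"

text \<open>Units, square-zero elements and idempotents are pushed forward along \<open>f\<close>;
  hence the absence of square-zero elements passes backwards.\<close>

lemma dot_invariants_imp:
  assumes "isomorphic_algebras scl dot circ scl' dot' circ'"
  shows "unital dot \<Longrightarrow> unital dot'" "square_zero_free dot' \<Longrightarrow> square_zero_free dot"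
    "has_idempotent dot \<Longrightarrow> has_idempotent dot'"
proof -
  obtain f where "Vector_Spaces.linear scl scl' f" "bij f"
    and h: "\<forall>x y. f (dot x y) = dot' (f x) (f y)"
    using assms unfolding isomorphic_algebras_def by blast
  interpret f: Vector_Spaces.linear scl scl' f by fact
  have surj: "\<exists>x. y = f x" for y using \<open>bij f\<close> by (metis bij_is_surj surjD)
  have inj: "x = 0" if "f x = 0" for x
    using \<open>bij f\<close> that f.zero by (metis bij_is_inj injD)
  show "unital dot'" if "unital dot"
  proof -
    obtain e where e: "\<forall>x. dot e x = x" using \<open>unital dot\<close> unfolding unital_def by blast
    have "dot' (f e) y = y" for y
    proof -
      obtain x where "y = f x" using surj by blast
      then show ?thesis using h e by metis
    qed
    then show ?thesis unfolding unital_def by blast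
  qed
  show "square_zero_free dot" if "square_zero_free dot'"
    using that h f.zero inj unfolding square_zero_free_def by metis
  show "has_idempotent dot'" if "has_idempotent dot"
    using that h inj unfolding has_idempotent_def by metis
qed

lemma dot_invariants:
  assumes "isomorphic_algebras scl dot circ scl' dot' circ'"
  shows "unital dot = unital dot'" "square_zero_free dot = square_zero_free dot'"
    "has_idempotent dot = has_idempotent dot'"
  using dot_invariants_imp[OF assms] dot_invariants_imp[OF isomorphic_algebras_sym[OF assms]]
  by blast+

lemma unital_table:
  "unital (table e1 0 0 e2)" "unital (table e1 e2 e2 0)"
  "\<not> unital (table e1 0 0 0)" "\<not> unital (table e2 0 0 0)"
proof -
  show "unital (table e1 0 0 e2)"
    unfolding unital_def by (rule exI[of _ "e1 + e2"]) (simp add: coordinates)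
  show "unital (table e1 e2 e2 0)"
    unfolding unital_def by (rule exI[of _ e1]) (simp add: coordinates)
  have "table e1 0 0 0 e e2 \<noteq> e2" "table e2 0 0 0 e e2 \<noteq> e2" for e
    by (simp_all add: coordinates)
  then show "\<not> unital (table e1 0 0 0)" "\<not> unital (table e2 0 0 0)"
    unfolding unital_def by blast+
qed

lemma square_zero_free_table:
  "square_zero_free (table e1 0 0 e2)" "\<not> square_zero_free (table e1 e2 e2 0)"
proof -
  show "square_zero_free (table e1 0 0 e2)"
    unfolding square_zero_free_def by (simp add: coordinates)
  have "table e1 e2 e2 0 e2 e2 = 0" "e2 \<noteq> 0"
    by (simp_all add: coordinates)
  then show "\<not> square_zero_free (table e1 e2 e2 0)"
    unfolding square_zero_free_def by blast
qed

lemma has_idempotent_table: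
  "has_idempotent (table e1 0 0 0)" "\<not> has_idempotent (table e2 0 0 0)"
proof -
  show "has_idempotent (table e1 0 0 0)"
    unfolding has_idempotent_def by (rule exI[of _ e1]) (simp add: coordinates)
  have "x = 0" if "table e2 0 0 0 x x = x" for x
    using that by (auto simp: coordinates)
  then show "\<not> has_idempotent (table e2 0 0 0)"
    unfolding has_idempotent_def by blast
qed

text \<open>An automorphism of the dual numbers fixes the unit and scales \<open>e2\<close> by some
  \<open>k\<close>. The equations compare the coordinates of \<open>\<circ>\<close> in the basis
  \<open>e1\<close>, \<open>k *s e2\<close>.\<close>

lemma isomorphic_table_e1_e2_e2_0:
  assumes "isomorphic_algebras (*s) (table e1 e2 e2 0) (table c11 c12 c21 c22)
    (*s) (table e1 e2 e2 0) (table q11 q12 q21 q22)"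
  obtains k where "k \<noteq> 0"
    "q11$1 = c11$1" "k * q11$2 = c11$2" "q12$1 = k * c12$1" "k * q12$2 = k * c12$2"
    "q21$1 = k * c21$1" "k * q21$2 = k * c21$2" "q22$1 = k^2 * c22$1" "k * q22$2 = k^2 * c22$2"
proof -
  obtain u v where d: "det2 u v \<noteq> 0"
    and "table e1 e2 e2 0 u u = lincomb (*s) u v e1" "table e1 e2 e2 0 u v = lincomb (*s) u v e2"
      "table e1 e2 e2 0 v v = lincomb (*s) u v 0"
    and c: "table c11 c12 c21 c22 u u = lincomb (*s) u v q11"
      "table c11 c12 c21 c22 u v = lincomb (*s) u v q12"
      "table c11 c12 c21 c22 v u = lincomb (*s) u v q21"
      "table c11 c12 c21 c22 v v = lincomb (*s) u v q22"
    using assms unfolding isomorphic_algebras_table_iff by blast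
  then have e: "v$1 = 0" "u$1 * u$1 = u$1" "u$2 = 0 \<or> 2 * u$1 = 1"
    by (auto simp: coordinates)
  then have "u$1 \<noteq> 0" "v$2 \<noteq> 0" using d by (auto simp: det2_def)
  then have "u$1 = 1" using e(2) by simp
  then have uv: "v$1 = 0" "u$1 = 1" "u$2 = 0" "v$2 \<noteq> 0"
    using e(1,3) \<open>v$2 \<noteq> 0\<close> by simp_all
  show ?thesis
    by (rule that[of "v$2"]) (use c uv in \<open>simp_all add: coordinates power2_eq_square mult.commute\<close>)
qed

text \<open>The nonzero idempotent \<open>e1\<close> is unique and the line of \<open>e2\<close> is
  the annihilator, so again an automorphism only scales \<open>e2\<close>.\<close>

lemma isomorphic_table_e1_0_0_0:
  assumes "isomorphic_algebras (*s) (table e1 0 0 0) (table c11 c12 c21 c22)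
    (*s) (table e1 0 0 0) (table q11 q12 q21 q22)"
  obtains k where "k \<noteq> 0"
    "q11$1 = c11$1" "k * q11$2 = c11$2" "q12$1 = k * c12$1" "k * q12$2 = k * c12$2"
    "q21$1 = k * c21$1" "k * q21$2 = k * c21$2" "q22$1 = k^2 * c22$1" "k * q22$2 = k^2 * c22$2"
proof -
  obtain u v where d: "det2 u v \<noteq> 0"
    and "table e1 0 0 0 u u = lincomb (*s) u v e1" "table e1 0 0 0 u v = lincomb (*s) u v 0"
      "table e1 0 0 0 v v = lincomb (*s) u v 0"
    and c: "table c11 c12 c21 c22 u u = lincomb (*s) u v q11"
      "table c11 c12 c21 c22 u v = lincomb (*s) u v q12"
      "table c11 c12 c21 c22 v u = lincomb (*s) u v q21"
      "table c11 c12 c21 c22 v v = lincomb (*s) u v q22"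
    using assms unfolding isomorphic_algebras_table_iff by blast
  then have "v$1 = 0" "u$1 * u$1 = u$1" "u$2 = 0"
    by (simp_all add: coordinates)
  moreover then have "u$1 \<noteq> 0" "v$2 \<noteq> 0" using d by (auto simp: det2_def)
  ultimately have uv: "v$1 = 0" "u$1 = 1" "u$2 = 0" "v$2 \<noteq> 0" by auto
  show ?thesis
    by (rule that[of "v$2"]) (use c uv in \<open>simp_all add: coordinates power2_eq_square mult.commute\<close>)
qed

text \<open>An automorphism is determined by the image \<open>(r, w)\<close> of \<open>e1\<close>,
  since \<open>e2\<close> is its square. Two products are kept; in a commutative pre-Lie algebra the
  derivation property yields the other two.\<close>

lemma isomorphic_table_e2_0_0_0:
  assumes "isomorphic_algebras (*s) (table e2 0 0 0) (table c11 c12 c21 c22)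
    (*s) (table e2 0 0 0) (table q11 q12 q21 q22)"
  obtains r w where "r \<noteq> 0"
    "table c11 c12 c21 c22 (vector [r, w]) (vector [r, w]) = vector [r * q11$1, w * q11$1 + r\<^sup>2 * q11$2]"
    "table c11 c12 c21 c22 (vector [0, r\<^sup>2]) (vector [r, w]) = vector [r * q21$1, w * q21$1 + r\<^sup>2 * q21$2]"
proof -
  obtain u v where d: "det2 u v \<noteq> 0"
    and "table e2 0 0 0 u u = lincomb (*s) u v e2"
    and c: "table c11 c12 c21 c22 u u = lincomb (*s) u v q11"
      "table c11 c12 c21 c22 v u = lincomb (*s) u v q21"
    using assms unfolding isomorphic_algebras_table_iff by blast
  then have v: "v$1 = 0" "v$2 = (u$1)\<^sup>2"
    by (simp_all add: coordinates power2_eq_square)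
  then have "u$1 \<noteq> 0" using d by (auto simp: det2_def)
  moreover have "u = vector [u$1, u$2]" "v = vector [0, (u$1)\<^sup>2]"
    by (simp_all add: vec_2_eq_iff v)
  moreover have "lincomb (*s) u v q = vector [u$1 * q$1, u$2 * q$1 + (u$1)\<^sup>2 * q$2]" for q
    by (simp add: coordinates v mult.commute)
  ultimately show ?thesis using that[of "u$1" "u$2"] c by metis
qed

lemma isomorphic_alg_family_b:
  assumes L: "L \<in> family_b" and M: "M \<in> family_b"
    and iso: "isomorphic_algebras (*s) (alg_dot L) (alg_circ L) (*s) (alg_dot M) (alg_circ M)"
  shows "L = M \<or> (\<exists>\<alpha>. L = C15 \<alpha> \<and> M = C15 (- \<alpha>))"
proof -
  have eq: "unital (alg_dot L) = unital (alg_dot M)"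
    "square_zero_free (alg_dot L) = square_zero_free (alg_dot M)"
    "has_idempotent (alg_dot L) = has_idempotent (alg_dot M)"
    using dot_invariants[OF iso] by blast+
  have forms: "K = C09 \<or> K \<in> insert C11 (range C10) \<or> K \<in> insert C13 (range C12) \<or>
      K \<in> {C14, C16} \<union> range C15 \<union> range C17" if "K \<in> family_b" for K
    using that by (auto simp: family_b_def)
  \<comment> \<open>The invariants leave only pairs with the same table for the commutative
    product.\<close>
  consider "L = C09" "M = C09" | "L \<in> insert C11 (range C10)" "M \<in> insert C11 (range C10)"
    | "L \<in> insert C13 (range C12)" "M \<in> insert C13 (range C12)"
    | "L \<in> {C14, C16} \<union> range C15 \<union> range C17" "M \<in> {C14, C16} \<union> range C15 \<union> range C17"
    using forms[OF L] forms[OF M] eq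
    by (elim disjE) (auto simp: unital_table square_zero_free_table has_idempotent_table)
  then show ?thesis
  proof cases
    case 1
    then show ?thesis by simp
  next
    case 2
    then show ?thesis using iso
      by (auto elim!: isomorphic_table_e1_e2_e2_0 simp: e_nth)
  next
    case 3
    then show ?thesis using iso
      by (auto elim!: isomorphic_table_e1_0_0_0 simp: e_nth)
  next
    case 4
    have C15: "\<beta> = \<alpha> \<or> \<beta> = - \<alpha>" if iso: "isomorphic_algebras (*s) (alg_dot (C15 \<alpha>)) (alg_circ (C15 \<alpha>))
      (*s) (alg_dot (C15 \<beta>)) (alg_circ (C15 \<beta>))" for \<alpha> \<beta>
    proof -
      from iso[unfolded alg_dot.simps alg_circ.simps] obtain r w where r: "r \<noteq> 0"
        and *: "table (\<alpha> *s e1) ((2 * \<alpha>) *s e2) (e1 + \<alpha> *s e2) (2 *s e2) (vector [r, w]) (vector [r, w]) =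
            vector [r * (\<beta> *s e1)$1, w * (\<beta> *s e1)$1 + r\<^sup>2 * (\<beta> *s e1)$2]"
          "table (\<alpha> *s e1) ((2 * \<alpha>) *s e2) (e1 + \<alpha> *s e2) (2 *s e2) (vector [0, r\<^sup>2]) (vector [r, w]) =
            vector [r * (e1 + \<beta> *s e2)$1, w * (e1 + \<beta> *s e2)$1 + r\<^sup>2 * (e1 + \<beta> *s e2)$2]"
        by (rule isomorphic_table_e2_0_0_0)
      have 1: "r * r * \<alpha> + w * r = r * \<beta>" and 2: "3 * r * w * \<alpha> + 2 * w * w = w * \<beta>"
        and 3: "r\<^sup>2 * r = r"
        using * by (simp_all add: coordinates algebra_simps)
      \<comment> \<open>Equation \<open>3\<close> leaves a sign for \<open>r\<close>. Once
        \<open>1\<close> has expressed \<beta> by \<open>w\<close>, equation \<open>2\<close> is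
        quadratic in \<open>w\<close>, and its two roots give \<beta> the values
        \<open>r * \<alpha>\<close> and \<open>- r * \<alpha>\<close>.\<close>
      have "r = 1 \<or> r = - 1" using 3 r by (simp add: power2_eq_1_iff)
      have \<beta>: "\<beta> = r * \<alpha> + w"
      proof -
        have "r * (\<beta> - (r * \<alpha> + w)) = 0" using 1 by algebra
        then show ?thesis using r by simp
      qed
      have "w * (w + 2 * r * \<alpha>) = 0" using 2 unfolding \<beta> by algebra
      then have "w = 0 \<or> w = - 2 * r * \<alpha>" by (auto simp: eq_neg_iff_add_eq_0)
      then show ?thesis using \<open>r = 1 \<or> r = - 1\<close> unfolding \<beta> by auto
    qed
    show ?thesis using 4 iso
      by (auto elim!: isomorphic_table_e2_0_0_0 simp: coordinates power2_eq_square dest!: C15)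
  qed
qed

theorem theorem49:
  "(\<forall>(scl :: complex \<Rightarrow> 'a::ab_group_add \<Rightarrow> 'a) dot circ.
      comm_pre_Lie_algebra scl dot circ \<and>
      vector_space.dim scl (UNIV :: 'a set) = 2 \<and>
      nonzero_products dot circ \<longrightarrow>
      (\<exists>L \<in> family_a \<union> family_b.
         isomorphic_algebras scl dot circ (*s) (alg_dot L) (alg_circ L))) \<and>
   (\<forall>L \<in> family_b. \<forall>M \<in> family_b.
      isomorphic_algebras (*s) (alg_dot L) (alg_circ L) (*s) (alg_dot M) (alg_circ M) \<longleftrightarrow>
      L = M \<or> (\<exists>\<alpha>. L = C15 \<alpha> \<and> M = C15 (- \<alpha>)))"
proof (intro conjI allI impI ballI)
  fix scl :: "complex \<Rightarrow> 'a \<Rightarrow> 'a" and dot circ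
  assume "comm_pre_Lie_algebra scl dot circ \<and> vector_space.dim scl (UNIV :: 'a set) = 2 \<and>
    nonzero_products dot circ"
  then show "\<exists>L \<in> family_a \<union> family_b. isomorphic_algebras scl dot circ (*s) (alg_dot L) (alg_circ L)"
    using ex_isomorphic_alg unfolding families(1) by blast
next
  fix L M
  assume "L \<in> family_b" "M \<in> family_b"
  then show "isomorphic_algebras (*s) (alg_dot L) (alg_circ L) (*s) (alg_dot M) (alg_circ M) \<longleftrightarrow>
      L = M \<or> (\<exists>\<alpha>. L = C15 \<alpha> \<and> M = C15 (- \<alpha>))"
    using isomorphic_alg_family_b isomorphic_alg_refl isomorphic_alg_C15_minus by metis
qed

end
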